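(* Let $G$ be an IYB group and let $H$ be a subgroup of $\mathrm{Sym}_n$ that is an IYB group. Then the wreath product $G\wr H$ of $G$ and $H$ is an IYB group.
   Context: $\mathrm{Fa}_m$ is the free abelian group (written multiplicatively) with basis $u_1,\dots,u_m$, and $\mathrm{Fa}_m\rtimes \mathrm{Sym}_m$ is the semidirect product for the natural action $\sigma(u_i)=u_{\sigma(i)}$, where $\mathrm{Sym}_m$ is the symmetric group of degree $m$. A finite group $G$ is an involutive Yang-Baxter (IYB) group if for some positive integer $m$ there is a map $\phi:\mathrm{Fa}_m\to \mathrm{Sym}_m$ such that $\{(a,\phi(a)) : a\in \mathrm{Fa}_m\}$ is a subgroup of $\mathrm{Fa}_m\rtimes \mathrm{Sym}_m$ and $G\cong\phi(\mathrm{Fa}_m)$. For $H\le \mathrm{Sym}_n$, the wreath product $G\wr H$ is the semidirect product $G^n\rtimes H$, where $H$ acts on $G^n$ by permuting the coordinates: $h\cdot(g_1,\dots,g_n)=(g_{h^{-1}(1)},\dots,g_{h^{-1}(n)})$. *)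

theory Defs
  imports "HOL-Algebra.Sym_Groups" "HOL-Algebra.Free_Abelian_Groups"
begin

definition semidirect_product ::
  "('a, 'c) monoid_scheme \<Rightarrow> ('b, 'd) monoid_scheme \<Rightarrow> ('b \<Rightarrow> 'a \<Rightarrow> 'a) \<Rightarrow> ('a \<times> 'b) monoid"
  where "semidirect_product N H \<alpha> =
    \<lparr>carrier = carrier N \<times> carrier H,
     mult = (\<lambda>(a, h) (b, k). (a \<otimes>\<^bsub>N\<^esub> \<alpha> h b, h \<otimes>\<^bsub>H\<^esub> k)),
     one = (\<one>\<^bsub>N\<^esub>, \<one>\<^bsub>H\<^esub>)\<rparr>"

text \<open>The library writes free abelian groups additively; the basis element \<open>u\<^sub>i\<close> is \<open>frag_of i\<close>.\<close>

definition Fa :: "nat \<Rightarrow> (nat \<Rightarrow>\<^sub>0 int) monoid"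
  where "Fa m = free_Abelian_group {1..m}"

text \<open>The endomorphism determined by \<open>u\<^sub>i \<mapsto> u\<^bsub>\<sigma>(i)\<^esub>\<close>.\<close>

definition Fa_action :: "(nat \<Rightarrow> nat) \<Rightarrow> (nat \<Rightarrow>\<^sub>0 int) \<Rightarrow> (nat \<Rightarrow>\<^sub>0 int)"
  where "Fa_action \<sigma> = frag_extend (\<lambda>i. frag_of (\<sigma> i))"

definition Fa_Sym :: "nat \<Rightarrow> ((nat \<Rightarrow>\<^sub>0 int) \<times> (nat \<Rightarrow> nat)) monoid"
  where "Fa_Sym m = semidirect_product (Fa m) (sym_group m) Fa_action"

definition IYB_group :: "('a, 'b) monoid_scheme \<Rightarrow> bool"
  where "IYB_group G \<longleftrightarrow>
    group G \<and> finite (carrier G) \<and>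
    (\<exists>m>0. \<exists>\<phi> \<in> carrier (Fa m) \<rightarrow> carrier (sym_group m).
       subgroup {(a, \<phi> a) | a. a \<in> carrier (Fa m)} (Fa_Sym m) \<and>
       G \<cong> (sym_group m)\<lparr>carrier := \<phi> ` carrier (Fa m)\<rparr>)"

text \<open>\<open>H\<close> is a set of permutations of \<open>{1..n}\<close>, intended to be a subgroup of \<open>sym_group n\<close>;
  elements of \<open>G\<^sup>n\<close> are extensional functions on \<open>{1..n}\<close>.\<close>

definition wreath_product ::
  "('a, 'b) monoid_scheme \<Rightarrow> nat \<Rightarrow> (nat \<Rightarrow> nat) set \<Rightarrow> ((nat \<Rightarrow> 'a) \<times> (nat \<Rightarrow> nat)) monoid"
  where "wreath_product G n H =
    semidirect_product (product_group {1..n} (\<lambda>_. G)) ((sym_group n)\<lparr>carrier := H\<rparr>)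
      (\<lambda>h g. \<lambda>i\<in>{1..n}. g (inv' h i))"

end

theory Submission
  imports Defs
begin

text \<open>
  An IYB structure on a finite group \<open>W\<close> amounts to a map \<open>w\<close> from a free abelian group
  onto \<open>W\<close> such that \<open>W\<close> acts faithfully on the basis \<open>X\<close> and
  \<open>w (a + w a \<cdot> c) = w a \<otimes> w c\<close>: the map \<open>\<phi>\<close> of the definition is \<open>w\<close> followed by the
  permutation representation, and this equation says that the graph of \<open>\<phi>\<close> is closed under
  multiplication. Such data are called an equivariant cover below. Naming the basis by
  an arbitrary finite set instead of \<open>{1..m}\<close>, and separating \<open>W\<close> from its image in the
  symmetric group, is what makes constructions easy; the lemmas \<open>IYB_group_imp_cover\<close> and
  \<open>IYB_group_if_cover\<close> translate between the two descriptions.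

  Given covers \<open>u\<close> of \<open>G\<close> with basis \<open>X\<close> and \<open>v\<close> of \<open>H\<close> with basis \<open>Y\<close>, the wreath product
  acts on the disjoint union of \<open>{1..n} \<times> X\<close> (imprimitively: \<open>h\<close> permutes the \<open>n\<close> copies of \<open>X\<close>
  and the coordinates of \<open>g\<close> act inside them) and \<open>Y\<close> (through \<open>H\<close>). The second part is needed
  because the permutations in \<open>H\<close> and the action on the basis \<open>Y\<close> are unrelated. An element of
  the free abelian group on this union is a tuple \<open>(a\<^sub>1, \<dots>, a\<^sub>n, b)\<close>, and
  it is sent to \<open>((u a\<^sub>1, \<dots>, u a\<^sub>n), v b)\<close>. The cocycle equation then
  holds coordinate by coordinate, since the \<open>i\<close>-th coordinate of \<open>(g, h) \<cdot> (c\<^sub>1, \<dots>, c\<^sub>n, d)\<close> is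
  \<open>g\<^sub>i \<cdot> c\<^sub>j\<close> with \<open>j = h\<inverse> i\<close>, which is the twist in the multiplication of the wreath product.
\<close>

section \<open>Homomorphisms of free abelian groups\<close>

definition frag_map :: "('x \<Rightarrow> 'y) \<Rightarrow> ('x \<Rightarrow>\<^sub>0 int) \<Rightarrow> ('y \<Rightarrow>\<^sub>0 int)"
  where "frag_map f = frag_extend (\<lambda>x. frag_of (f x))"

lemma frag_extend_frag_extend:
  "frag_extend f (frag_extend g c) = frag_extend (\<lambda>x. frag_extend f (g x)) c"
proof -
  have "Poly_Mapping.keys c \<subseteq> UNIV"
    by simp
  then show ?thesis
    by (induction c rule: frag_induction) (auto simp: frag_extend_diff)
qed

lemma frag_extend_cong_on:
  assumes "Poly_Mapping.keys c \<subseteq> X" "\<And>x. x \<in> X \<Longrightarrow> f x = g x"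
  shows "frag_extend f c = frag_extend g c"
  using assms by (auto intro: frag_extend_eq)

lemma frag_extend_keys_subset:
  assumes "Poly_Mapping.keys c \<subseteq> X" "\<And>x. x \<in> X \<Longrightarrow> Poly_Mapping.keys (f x) \<subseteq> Y"
  shows "Poly_Mapping.keys (frag_extend f c) \<subseteq> Y"
  using keys_frag_extend[of f c] assms by blast

lemma frag_map_keys_subset:
  assumes "Poly_Mapping.keys c \<subseteq> X" "\<And>x. x \<in> X \<Longrightarrow> f x \<in> Y"
  shows "Poly_Mapping.keys (frag_map f c) \<subseteq> Y"
  unfolding frag_map_def using assms(1) by (rule frag_extend_keys_subset) (simp add: assms(2))

lemma frag_map_compose: "frag_map f (frag_map g c) = frag_map (\<lambda>x. f (g x)) c"
  by (simp add: frag_map_def frag_extend_frag_extend)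

lemma frag_map_cong_on:
  assumes "Poly_Mapping.keys c \<subseteq> X" "\<And>x. x \<in> X \<Longrightarrow> f x = g x"
  shows "frag_map f c = frag_map g c"
  unfolding frag_map_def using assms(1) by (rule frag_extend_cong_on) (simp add: assms(2))

lemma frag_map_ident_on:
  assumes "Poly_Mapping.keys c \<subseteq> X" "\<And>x. x \<in> X \<Longrightarrow> f x = x"
  shows "frag_map f c = c"
proof -
  have "frag_map f c = frag_extend frag_of c"
    unfolding frag_map_def using assms(1) by (rule frag_extend_cong_on) (simp add: assms(2))
  then show ?thesis
    by (simp flip: frag_expansion)
qed

lemma frag_map_add: "frag_map f (a + b) = frag_map f a + frag_map f b"
  by (simp add: frag_map_def frag_extend_add)

lemma frag_map_minus: "frag_map f (- a) = - frag_map f a"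
  by (simp add: frag_map_def frag_extend_minus)

lemma frag_map_0: "frag_map f 0 = 0"
  by (simp add: frag_map_def)

section \<open>Semidirect products\<close>

lemma semidirect_product_simps [simp]:
  "carrier (semidirect_product N H \<alpha>) = carrier N \<times> carrier H"
  "(a, h) \<otimes>\<^bsub>semidirect_product N H \<alpha>\<^esub> (b, k) = (a \<otimes>\<^bsub>N\<^esub> \<alpha> h b, h \<otimes>\<^bsub>H\<^esub> k)"
  "\<one>\<^bsub>semidirect_product N H \<alpha>\<^esub> = (\<one>\<^bsub>N\<^esub>, \<one>\<^bsub>H\<^esub>)"
  by (simp_all add: semidirect_product_def)

lemma group_semidirect_product:
  assumes N: "group N" and H: "group H"
    and hom: "\<And>h. h \<in> carrier H \<Longrightarrow> \<alpha> h \<in> hom N N"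
    and act_mult: "\<And>h k a. h \<in> carrier H \<Longrightarrow> k \<in> carrier H \<Longrightarrow> a \<in> carrier N \<Longrightarrow>
          \<alpha> (h \<otimes>\<^bsub>H\<^esub> k) a = \<alpha> h (\<alpha> k a)"
    and act_one: "\<And>a. a \<in> carrier N \<Longrightarrow> \<alpha> \<one>\<^bsub>H\<^esub> a = a"
  shows "group (semidirect_product N H \<alpha>)"
proof -
  interpret N: group N by (fact N)
  interpret H: group H by (fact H)
  have closed: "\<alpha> h a \<in> carrier N" if "h \<in> carrier H" "a \<in> carrier N" for h a
    using hom that by (auto simp: hom_def)
  have mult: "\<alpha> h (a \<otimes>\<^bsub>N\<^esub> b) = \<alpha> h a \<otimes>\<^bsub>N\<^esub> \<alpha> h b"
    if "h \<in> carrier H" "a \<in> carrier N" "b \<in> carrier N" for h a b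
    using hom that by (auto simp: hom_def)
  have one: "\<alpha> h \<one>\<^bsub>N\<^esub> = \<one>\<^bsub>N\<^esub>" if "h \<in> carrier H" for h
    using hom_one[OF hom[OF that] N N] .
  show ?thesis
  proof (rule groupI)
    fix x assume "x \<in> carrier (semidirect_product N H \<alpha>)"
    then obtain a h where x: "x = (a, h)" "a \<in> carrier N" "h \<in> carrier H"
      by auto
    let ?y = "(\<alpha> (inv\<^bsub>H\<^esub> h) (inv\<^bsub>N\<^esub> a), inv\<^bsub>H\<^esub> h)"
    have "?y \<otimes>\<^bsub>semidirect_product N H \<alpha>\<^esub> x = \<one>\<^bsub>semidirect_product N H \<alpha>\<^esub>"
      using x by (simp add: one flip: mult)
    moreover have "?y \<in> carrier (semidirect_product N H \<alpha>)"
      using x by (simp add: closed)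
    ultimately show "\<exists>y\<in>carrier (semidirect_product N H \<alpha>).
        y \<otimes>\<^bsub>semidirect_product N H \<alpha>\<^esub> x = \<one>\<^bsub>semidirect_product N H \<alpha>\<^esub>"
      by blast
  qed (auto simp: closed mult act_mult act_one N.m_assoc H.m_assoc)
qed

section \<open>Equivariant covers\<close>

text \<open>
  The action is only constrained on \<open>X\<close>, so that no convention for its values elsewhere has to be
  carried through the constructions.
\<close>

locale equivariant_cover = group W
  for W :: "('w, 'v) monoid_scheme" (structure) +
  fixes X :: "'x set" and act :: "'w \<Rightarrow> 'x \<Rightarrow> 'x" and w :: "('x \<Rightarrow>\<^sub>0 int) \<Rightarrow> 'w"
  assumes finite_basis: "finite X" and basis_nonempty: "X \<noteq> {}"
    and act_closed: "g \<in> carrier W \<Longrightarrow> x \<in> X \<Longrightarrow> act g x \<in> X"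
    and act_one: "x \<in> X \<Longrightarrow> act \<one> x = x"
    and act_mult: "g \<in> carrier W \<Longrightarrow> h \<in> carrier W \<Longrightarrow> x \<in> X \<Longrightarrow>
          act (g \<otimes> h) x = act g (act h x)"
    and faithful: "g \<in> carrier W \<Longrightarrow> (\<And>x. x \<in> X \<Longrightarrow> act g x = x) \<Longrightarrow> g = \<one>"
    and onto: "w ` {a. Poly_Mapping.keys a \<subseteq> X} = carrier W"
    and cocycle: "Poly_Mapping.keys a \<subseteq> X \<Longrightarrow> Poly_Mapping.keys c \<subseteq> X \<Longrightarrow>
          w (a + frag_map (act (w a)) c) = w a \<otimes> w c"
begin

lemma cover_closed: "Poly_Mapping.keys a \<subseteq> X \<Longrightarrow> w a \<in> carrier W"
  using onto by blast

lemma cover_surj: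
  assumes "g \<in> carrier W"
  obtains a where "Poly_Mapping.keys a \<subseteq> X" "w a = g"
  using assms unfolding onto[symmetric] by blast

lemma cover_zero: "w 0 = \<one>"
proof -
  have "w 0 \<otimes> w 0 = w 0"
    using cocycle[of 0 0] by (simp add: frag_map_0)
  then show ?thesis
    using cover_closed[of 0] by (simp add: r_cancel_one)
qed

lemma act_cancel:
  assumes "g \<in> carrier W" "x \<in> X"
  shows "act (inv g) (act g x) = x" "act g (act (inv g) x) = x"
  using assms act_mult[of "inv g" g x] act_mult[of g "inv g" x] by (simp_all add: act_one)

lemma act_bij_betw:
  assumes "g \<in> carrier W"
  shows "bij_betw (act g) X X"
  using assms by (intro bij_betw_byWitness[where f' = "act (inv g)"])
    (auto simp: act_cancel act_closed)

lemma act_eqD: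
  assumes "g \<in> carrier W" "h \<in> carrier W" "\<And>x. x \<in> X \<Longrightarrow> act g x = act h x"
  shows "g = h"
proof -
  have "inv h \<otimes> g = \<one>"
    using assms by (intro faithful) (auto simp: act_mult act_cancel)
  then show ?thesis
    using assms by (metis inv_closed inv_equality inv_inv)
qed

text \<open>
  Inverting \<open>(a, w a)\<close> in the semidirect product of the free abelian group and \<open>W\<close> gives the
  first coordinate \<open>- w(a)\<inverse> \<cdot> a\<close>.
\<close>

lemma cover_inverse:
  assumes "Poly_Mapping.keys a \<subseteq> X"
  shows "w (- frag_map (act (inv w a)) a) = inv (w a)"
proof -
  let ?c = "- frag_map (act (inv w a)) a"
  have wa: "w a \<in> carrier W"
    using assms by (rule cover_closed)
  have c: "Poly_Mapping.keys ?c \<subseteq> X"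
    unfolding keys_minus using assms by (rule frag_map_keys_subset) (simp add: wa act_closed)
  have "frag_map (act (w a)) ?c = - a"
    using assms wa
    by (simp add: frag_map_minus frag_map_compose frag_map_ident_on[OF assms] act_cancel)
  then have "w a \<otimes> w ?c = \<one>"
    using cocycle[OF assms c] by (simp add: cover_zero)
  then show ?thesis
    using wa cover_closed[OF c] by (metis inv_equality inv_inv inv_closed)
qed

end

section \<open>Covers and IYB structures\<close>

lemma Fa_simps [simp]:
  "a \<in> carrier (Fa m) \<longleftrightarrow> Poly_Mapping.keys a \<subseteq> {1..m}"
  "a \<otimes>\<^bsub>Fa m\<^esub> b = a + b" "\<one>\<^bsub>Fa m\<^esub> = 0" "group (Fa m)"
  by (simp_all add: Fa_def)

lemma Fa_action_eq_frag_map: "Fa_action \<sigma> = frag_map \<sigma>"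
  by (simp add: Fa_action_def frag_map_def)

lemma group_Fa_Sym: "group (Fa_Sym m)"
  unfolding Fa_Sym_def
proof (rule group_semidirect_product)
  fix \<sigma> assume "\<sigma> \<in> carrier (sym_group m)"
  then have perm: "\<sigma> permutes {1..m}"
    by (simp add: sym_group_carrier)
  have "Poly_Mapping.keys (frag_map \<sigma> a) \<subseteq> {1..m}" if "Poly_Mapping.keys a \<subseteq> {1..m}" for a
    using that by (rule frag_map_keys_subset) (simp only: permutes_in_image[OF perm])
  then show "Fa_action \<sigma> \<in> hom (Fa m) (Fa m)"
    by (simp add: hom_def Fa_action_eq_frag_map frag_map_add Pi_def)
qed (auto simp: sym_group_is_group Fa_action_eq_frag_map sym_group_mult sym_group_one
    frag_map_compose o_def intro!: frag_map_ident_on)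

text \<open>
  The isomorphism from \<open>G\<close> onto the permutation group \<open>\<phi>(Fa\<^sub>m)\<close> is itself the action, and pulling
  \<open>\<phi>\<close> back along it gives the cover.
\<close>

lemma IYB_group_imp_cover:
  assumes "IYB_group G"
  shows "\<exists>m act w. equivariant_cover G {1..m::nat} act w"
proof -
  obtain m \<phi> where G: "group G" and m: "m > 0"
    and \<phi>: "\<phi> \<in> carrier (Fa m) \<rightarrow> carrier (sym_group m)"
    and graph: "subgroup {(a, \<phi> a) | a. a \<in> carrier (Fa m)} (Fa_Sym m)"
    and "G \<cong> (sym_group m)\<lparr>carrier := \<phi> ` carrier (Fa m)\<rparr>"
    using assms by (auto simp: IYB_group_def)
  then obtain \<theta> where \<theta>: "\<theta> \<in> iso G ((sym_group m)\<lparr>carrier := \<phi> ` carrier (Fa m)\<rparr>)"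
    by (auto simp: is_iso_def)
  interpret group G by (fact G)
  have bij: "bij_betw \<theta> (carrier G) (\<phi> ` carrier (Fa m))"
    and mult: "\<And>g h. g \<in> carrier G \<Longrightarrow> h \<in> carrier G \<Longrightarrow> \<theta> (g \<otimes>\<^bsub>G\<^esub> h) = \<theta> g \<circ> \<theta> h"
    using \<theta> by (auto simp: iso_def hom_def sym_group_mult)
  have perm: "\<theta> g permutes {1..m}" if "g \<in> carrier G" for g
  proof -
    have "\<theta> g \<in> \<phi> ` carrier (Fa m)"
      using bij that by (auto simp: bij_betw_def)
    then have "\<theta> g \<in> carrier (sym_group m)"
      using funcset_image[OF \<phi>] by blast
    then show ?thesis
      by (simp only: sym_group_carrier)
  qed
  have one: "\<theta> \<one>\<^bsub>G\<^esub> = id"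
  proof
    fix x
    have "\<theta> \<one>\<^bsub>G\<^esub> (\<theta> \<one>\<^bsub>G\<^esub> x) = \<theta> \<one>\<^bsub>G\<^esub> x"
      using mult[of "\<one>\<^bsub>G\<^esub>" "\<one>\<^bsub>G\<^esub>"] by (simp add: fun_eq_iff)
    then show "\<theta> \<one>\<^bsub>G\<^esub> x = id x"
      using permutes_inj[OF perm[OF one_closed]] by (simp add: inj_eq)
  qed
  define w where "w a = inv_into (carrier G) \<theta> (\<phi> a)" for a
  have \<theta>_w: "\<theta> (w a) = \<phi> a" and w_closed: "w a \<in> carrier G"
    if "Poly_Mapping.keys a \<subseteq> {1..m}" for a
  proof -
    have "\<phi> a \<in> \<theta> ` carrier G"
      using bij that by (auto simp: bij_betw_def)
    then show "\<theta> (w a) = \<phi> a" "w a \<in> carrier G"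
      unfolding w_def by (auto intro: f_inv_into_f inv_into_into)
  qed
  have cocycle: "\<phi> (a + frag_map (\<phi> a) c) = \<phi> a \<circ> \<phi> c"
    and add_closed: "Poly_Mapping.keys (a + frag_map (\<phi> a) c) \<subseteq> {1..m}"
    if "Poly_Mapping.keys a \<subseteq> {1..m}" "Poly_Mapping.keys c \<subseteq> {1..m}" for a c
    using subgroup.m_closed[OF graph, of "(a, \<phi> a)" "(c, \<phi> c)"] that
    by (auto simp: Fa_Sym_def Fa_action_eq_frag_map sym_group_mult)
  have inj: "g = h" if "g \<in> carrier G" "h \<in> carrier G" "\<theta> g = \<theta> h" for g h
    using bij that by (auto simp: bij_betw_def inj_on_def)
  have "equivariant_cover G {1..m} \<theta> w"
  proof
    fix g x assume "g \<in> carrier G" "x \<in> {1..m}"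
    then show "\<theta> g x \<in> {1..m}"
      by (simp only: permutes_in_image[OF perm])
  next
    fix g assume g: "g \<in> carrier G" and fixed: "\<And>x. x \<in> {1..m} \<Longrightarrow> \<theta> g x = x"
    have "\<theta> g x = x" for x
      using fixed permutes_not_in[OF perm[OF g]] by (cases "x \<in> {1..m}") auto
    then have "\<theta> g = \<theta> \<one>\<^bsub>G\<^esub>"
      by (simp add: one fun_eq_iff)
    then show "g = \<one>\<^bsub>G\<^esub>"
      by (rule inj[OF g one_closed])
  next
    show "w ` {a. Poly_Mapping.keys a \<subseteq> {1..m}} = carrier G"
    proof
      show "carrier G \<subseteq> w ` {a. Poly_Mapping.keys a \<subseteq> {1..m}}"
      proof
        fix g assume g: "g \<in> carrier G"
        then have "\<theta> g \<in> \<phi> ` carrier (Fa m)"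
          using bij_betw_imp_surj_on[OF bij] by blast
        then obtain a where a: "Poly_Mapping.keys a \<subseteq> {1..m}" "\<theta> g = \<phi> a"
          unfolding image_iff Bex_def Fa_simps by blast
        have "g = w a"
          by (rule inj[OF g w_closed[OF a(1)]]) (simp only: \<theta>_w[OF a(1)] a(2))
        then show "g \<in> w ` {a. Poly_Mapping.keys a \<subseteq> {1..m}}"
          using a by blast
      qed
    qed (auto simp: w_closed)
  next
    fix a c :: "nat \<Rightarrow>\<^sub>0 int"
    assume ac: "Poly_Mapping.keys a \<subseteq> {1..m}" "Poly_Mapping.keys c \<subseteq> {1..m}"
    show "w (a + frag_map (\<theta> (w a)) c) = w a \<otimes>\<^bsub>G\<^esub> w c"
    proof (rule inj)
      show "w (a + frag_map (\<theta> (w a)) c) \<in> carrier G"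
        using ac add_closed[OF ac] by (simp add: w_closed \<theta>_w)
      show "\<theta> (w (a + frag_map (\<theta> (w a)) c)) = \<theta> (w a \<otimes>\<^bsub>G\<^esub> w c)"
        using ac add_closed[OF ac] by (simp add: w_closed \<theta>_w mult cocycle)
    qed (use ac in \<open>simp add: w_closed\<close>)
  qed (use m in \<open>auto simp: one mult\<close>)
  then show ?thesis
    by blast
qed

text \<open>
  Conversely, numbering the basis turns the action into a permutation representation \<open>perm\<close> of
  \<open>W\<close> on \<open>{1..m}\<close>, and \<open>\<phi>\<close> is the composite of \<open>perm\<close> with the renamed cover.
\<close>

lemma IYB_group_if_cover:
  assumes "equivariant_cover W X act w"
  shows "IYB_group W"
proof -
  interpret equivariant_cover W X act w by (fact assms)
  define m where "m = card X"
  have "card X = card {1..m}"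
    by (simp add: m_def)
  then obtain f where f: "bij_betw f X {1..m}"
    using finite_same_card_bij[OF finite_basis finite_atLeastAtMost] by blast
  define e where "e = inv_into X f"
  have e: "bij_betw e {1..m} X"
    unfolding e_def by (rule bij_betw_inv_into[OF f])
  have f_in: "f x \<in> {1..m}" and ef: "e (f x) = x" if "x \<in> X" for x
    using bij_betwE[OF f] bij_betw_inv_into_left[OF f that] that by (simp_all only: e_def)
  have e_in: "e k \<in> X" and fe: "f (e k) = k" if "k \<in> {1..m}" for k
    using bij_betwE[OF e] bij_betw_inv_into_right[OF f that] that by (simp_all only: e_def)
  define perm where "perm g = (\<lambda>k. if k \<in> {1..m} then f (act g (e k)) else k)" for g
  have perm: "perm g permutes {1..m}" if "g \<in> carrier W" for g
  proof (rule bij_imp_permutes)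
    have "bij_betw (f \<circ> (act g \<circ> e)) {1..m} {1..m}"
      using act_bij_betw[OF that] e f by (blast intro: bij_betw_trans)
    then show "bij_betw (perm g) {1..m} {1..m}"
      by (subst bij_betw_cong[of _ _ "f \<circ> (act g \<circ> e)"]) (auto simp: perm_def)
  qed (auto simp: perm_def)
  have perm_mult: "perm (g \<otimes>\<^bsub>W\<^esub> h) = perm g \<circ> perm h"
    if "g \<in> carrier W" "h \<in> carrier W" for g h
  proof
    fix k
    show "perm (g \<otimes>\<^bsub>W\<^esub> h) k = (perm g \<circ> perm h) k"
    proof (cases "k \<in> {1..m}")
      case True
      then have "f (act h (e k)) \<in> {1..m}"
        by (intro f_in act_closed that e_in)
      then show ?thesis
        using True that by (auto simp del: One_nat_def simp: perm_def act_mult e_in ef act_closed)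
    qed (auto simp: perm_def)
  qed
  have perm_inj: "inj_on perm (carrier W)"
  proof (rule inj_onI, rule act_eqD)
    fix g h x assume gh: "g \<in> carrier W" "h \<in> carrier W" "perm g = perm h" and x: "x \<in> X"
    have "f (act g x) = f (act h x)"
      using fun_cong[OF gh(3), of "f x"] f_in[OF x] x by (simp add: perm_def ef)
    then show "act g x = act h x"
      using gh x by (metis ef act_closed)
  qed
  define \<phi> where "\<phi> c = perm (w (frag_map e c))" for c
  have T: "Poly_Mapping.keys (frag_map e c) \<subseteq> X" if "Poly_Mapping.keys c \<subseteq> {1..m}" for c
    using that by (rule frag_map_keys_subset) (rule e_in)
  have T_perm: "frag_map e (frag_map (perm g) c) = frag_map (act g) (frag_map e c)"
    if "Poly_Mapping.keys c \<subseteq> {1..m}" "g \<in> carrier W" for c g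
    unfolding frag_map_compose using that
    by (intro frag_map_cong_on[OF that(1)]) (auto simp: perm_def ef e_in act_closed)
  have w_T: "w (frag_map e c) \<in> carrier W" if "Poly_Mapping.keys c \<subseteq> {1..m}" for c
    by (intro cover_closed T that)
  have \<phi>_perm: "\<phi> c permutes {1..m}" if "Poly_Mapping.keys c \<subseteq> {1..m}" for c
    unfolding \<phi>_def by (intro perm w_T that)
  have \<phi>_in: "\<phi> c k \<in> {1..m}" if "Poly_Mapping.keys c \<subseteq> {1..m}" "k \<in> {1..m}" for c k
    using that by (simp only: permutes_in_image[OF \<phi>_perm])
  have image: "\<phi> ` carrier (Fa m) = perm ` carrier W"
  proof (intro equalityI subsetI)
    fix p assume "p \<in> perm ` carrier W"
    then obtain a where a: "p = perm (w a)" "Poly_Mapping.keys a \<subseteq> X"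
      by (auto elim: cover_surj)
    have "frag_map e (frag_map f a) = a"
      unfolding frag_map_compose using a(2) ef by (rule frag_map_ident_on)
    then have "p = \<phi> (frag_map f a)"
      by (simp add: \<phi>_def a)
    moreover have "Poly_Mapping.keys (frag_map f a) \<subseteq> {1..m}"
      using a(2) f_in by (rule frag_map_keys_subset)
    ultimately show "p \<in> \<phi> ` carrier (Fa m)"
      by auto
  qed (auto simp: \<phi>_def w_T)
  have cocycle: "\<phi> (a + frag_map (\<phi> a) c) = \<phi> a \<circ> \<phi> c"
    if "Poly_Mapping.keys a \<subseteq> {1..m}" "Poly_Mapping.keys c \<subseteq> {1..m}" for a c
    using that unfolding \<phi>_def
    by (simp del: One_nat_def
        add: frag_map_add T_perm w_T equivariant_cover.cocycle[OF assms] T perm_mult)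
  have closed: "Poly_Mapping.keys (a + frag_map (\<phi> a) c) \<subseteq> {1..m}"
    if "Poly_Mapping.keys a \<subseteq> {1..m}" "Poly_Mapping.keys c \<subseteq> {1..m}" for a c
  proof -
    have "Poly_Mapping.keys (frag_map (\<phi> a) c) \<subseteq> {1..m}"
      using that(2) by (rule frag_map_keys_subset) (rule \<phi>_in[OF that(1)])
    then show ?thesis
      using keys_add[of a "frag_map (\<phi> a) c"] that(1) by blast
  qed
  let ?graph = "{(a, \<phi> a) | a. a \<in> carrier (Fa m)}"
  have "subgroup ?graph (Fa_Sym m)"
  proof (rule group.subgroupI[OF group_Fa_Sym])
    show "?graph \<subseteq> carrier (Fa_Sym m)"
      by (auto simp del: One_nat_def simp: Fa_Sym_def sym_group_carrier \<phi>_perm)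
    show "?graph \<noteq> {}"
      using group.is_monoid[OF Fa_simps(4), THEN monoid.one_closed] by blast
  next
    fix p assume "p \<in> ?graph"
    then obtain a where p: "p = (a, \<phi> a)" and a: "Poly_Mapping.keys a \<subseteq> {1..m}"
      by auto
    let ?g = "inv\<^bsub>W\<^esub> w (frag_map e a)"
    let ?b = "- frag_map (perm ?g) a"
    have g: "?g \<in> carrier W"
      using w_T[OF a] by simp
    have b: "Poly_Mapping.keys ?b \<subseteq> {1..m}"
      unfolding keys_minus using a
      by (rule frag_map_keys_subset) (simp only: permutes_in_image[OF perm[OF g]])
    have "frag_map e ?b = - frag_map (act ?g) (frag_map e a)"
      by (simp del: One_nat_def add: frag_map_minus T_perm[OF a g])
    then have \<phi>_b: "w (frag_map e ?b) = ?g"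
      by (simp del: One_nat_def add: cover_inverse T a)
    \<comment> \<open>It suffices to multiply in the order in which the action of the inverse permutation
        on \<open>a\<close> cancels at once.\<close>
    have zero: "?b + frag_map (\<phi> ?b) a = 0"
      by (simp add: \<phi>_def \<phi>_b)
    have "\<phi> ?b \<circ> \<phi> a = \<phi> 0"
      using cocycle[OF b a] zero by simp
    also have "\<phi> 0 = perm \<one>\<^bsub>W\<^esub>"
      by (simp add: \<phi>_def frag_map_0 cover_zero)
    also have "perm \<one>\<^bsub>W\<^esub> = id"
      by (auto simp del: One_nat_def simp: perm_def act_one e_in fe)
    finally have "(?b, \<phi> ?b) \<otimes>\<^bsub>Fa_Sym m\<^esub> p = \<one>\<^bsub>Fa_Sym m\<^esub>"
      using zero by (simp add: p Fa_Sym_def Fa_action_eq_frag_map sym_group_mult sym_group_one)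
    moreover have "p \<in> carrier (Fa_Sym m)" "(?b, \<phi> ?b) \<in> carrier (Fa_Sym m)"
      using a b by (auto simp del: One_nat_def simp: p Fa_Sym_def sym_group_carrier \<phi>_perm)
    ultimately have "inv\<^bsub>Fa_Sym m\<^esub> p = (?b, \<phi> ?b)"
      by (intro group.inv_equality[OF group_Fa_Sym])
    then show "inv\<^bsub>Fa_Sym m\<^esub> p \<in> ?graph"
      using b by auto
  next
    fix p q assume "p \<in> ?graph" "q \<in> ?graph"
    then show "p \<otimes>\<^bsub>Fa_Sym m\<^esub> q \<in> ?graph"
      using closed cocycle
      by (auto simp del: One_nat_def simp: Fa_Sym_def Fa_action_eq_frag_map sym_group_mult)
  qed
  moreover have "W \<cong> (sym_group m)\<lparr>carrier := \<phi> ` carrier (Fa m)\<rparr>"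
  proof -
    have "perm \<in> iso W ((sym_group m)\<lparr>carrier := perm ` carrier W\<rparr>)"
      using perm_inj by (auto simp: iso_def hom_def perm_mult sym_group_mult bij_betw_def)
    then show ?thesis
      unfolding image by (auto simp: is_iso_def)
  qed
  moreover have "\<phi> \<in> carrier (Fa m) \<rightarrow> carrier (sym_group m)"
    by (auto simp del: One_nat_def simp: sym_group_carrier \<phi>_perm)
  moreover have "m > 0"
    using finite_basis basis_nonempty by (simp add: m_def card_gt_0_iff)
  moreover have "finite (carrier W)"
  proof (rule finite_imageD[OF _ perm_inj])
    show "finite (perm ` carrier W)"
      by (rule finite_subset[OF _ finite_permutations[of "{1..m}"]])
        (auto simp del: One_nat_def simp: perm)
  qed
  ultimately show ?thesis
    unfolding IYB_group_def using is_group by blast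
qed

section \<open>The wreath product of two covers\<close>

lemma wreath_product_simps [simp]:
  "carrier (wreath_product G n H) = ({1..n} \<rightarrow>\<^sub>E carrier G) \<times> H"
  "(g, h) \<otimes>\<^bsub>wreath_product G n H\<^esub> (g', h') =
     (\<lambda>i\<in>{1..n}. g i \<otimes>\<^bsub>G\<^esub> (\<lambda>i\<in>{1..n}. g' (inv' h i)) i, h \<circ> h')"
  "\<one>\<^bsub>wreath_product G n H\<^esub> = (\<lambda>i\<in>{1..n}. \<one>\<^bsub>G\<^esub>, id)"
  by (simp_all add: wreath_product_def sym_group_mult sym_group_one)

lemma group_wreath_product:
  assumes "group G" "subgroup H (sym_group n)"
  shows "group (wreath_product G n H)"
proof -
  interpret G: group G by (fact assms)
  have perm: "h permutes {1..n}" if "h \<in> H" for h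
    using subgroup.subset[OF assms(2)] that by (auto simp: subset_iff sym_group_carrier)
  have inv_in: "inv' h i \<in> {1..n}" if "h \<in> H" "i \<in> {1..n}" for h i
    using that by (simp only: permutes_in_image[OF permutes_inv[OF perm]])
  show ?thesis
    unfolding wreath_product_def
  proof (rule group_semidirect_product)
    show "group ((sym_group n)\<lparr>carrier := H\<rparr>)"
      using assms(2) sym_group_is_group by (rule subgroup.subgroup_is_group)
    show "(\<lambda>g. \<lambda>i\<in>{1..n}. g (inv' h i)) \<in> hom (product_group {1..n} (\<lambda>_. G)) (product_group {1..n} (\<lambda>_. G))"
      if "h \<in> carrier ((sym_group n)\<lparr>carrier := H\<rparr>)" for h
      using that inv_in[of h] by (auto simp: hom_def PiE_iff fun_eq_iff)
    show "(\<lambda>i\<in>{1..n}. a (inv' (h \<otimes>\<^bsub>(sym_group n)\<lparr>carrier := H\<rparr>\<^esub> k) i)) =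
        (\<lambda>i\<in>{1..n}. (\<lambda>i\<in>{1..n}. a (inv' k i)) (inv' h i))"
      if "h \<in> carrier ((sym_group n)\<lparr>carrier := H\<rparr>)" "k \<in> carrier ((sym_group n)\<lparr>carrier := H\<rparr>)"
      for h k :: "nat \<Rightarrow> nat" and a :: "nat \<Rightarrow> 'a"
    proof -
      have "inv' (h \<circ> k) = inv' k \<circ> inv' h"
        using that perm permutes_bij by (intro o_inv_distrib) auto
      then show ?thesis
        using that inv_in[of h] by (auto simp: sym_group_mult fun_eq_iff)
    qed
  qed (auto simp: sym_group_one PiE_iff extensional_def assms(1) fun_eq_iff)
qed

text \<open>The coordinates of an element of the free abelian group on the disjoint union of \<open>I \<times> X\<close> and \<open>Y\<close>.\<close>

definition block :: "'i \<Rightarrow> ('i \<times> 'x + 'y \<Rightarrow>\<^sub>0 int) \<Rightarrow> ('x \<Rightarrow>\<^sub>0 int)"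
  where "block i = frag_extend (case_sum (\<lambda>(j, x). if j = i then frag_of x else 0) (\<lambda>_. 0))"

definition tail :: "('i \<times> 'x + 'y \<Rightarrow>\<^sub>0 int) \<Rightarrow> ('y \<Rightarrow>\<^sub>0 int)"
  where "tail = frag_extend (case_sum (\<lambda>_. 0) frag_of)"

lemma block_add: "block i (a + b) = block i a + block i b"
  by (simp add: block_def frag_extend_add)

lemma tail_add: "tail (a + b) = tail a + tail b"
  by (simp add: tail_def frag_extend_add)

lemma block_keys_subset:
  assumes "Poly_Mapping.keys a \<subseteq> (I \<times> X) <+> Y"
  shows "Poly_Mapping.keys (block i a) \<subseteq> X"
  unfolding block_def using assms by (rule frag_extend_keys_subset) (auto split: if_splits)

lemma tail_keys_subset:
  assumes "Poly_Mapping.keys a \<subseteq> (I \<times> X) <+> Y"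
  shows "Poly_Mapping.keys (tail a) \<subseteq> Y"
  unfolding tail_def using assms by (rule frag_extend_keys_subset) auto

lemma exists_blocks_tail:
  fixes c :: "'i \<Rightarrow> ('x \<Rightarrow>\<^sub>0 int)" and d :: "'y \<Rightarrow>\<^sub>0 int"
  assumes "finite I" "\<And>i. i \<in> I \<Longrightarrow> Poly_Mapping.keys (c i) \<subseteq> X" "Poly_Mapping.keys d \<subseteq> Y"
  shows "\<exists>a. Poly_Mapping.keys a \<subseteq> (I \<times> X) <+> Y \<and> (\<forall>i\<in>I. block i a = c i) \<and> tail a = d"
proof -
  let ?s = "\<Sum>j\<in>I. frag_map (\<lambda>x. Inl (j, x)) (c j) :: 'i \<times> 'x + 'y \<Rightarrow>\<^sub>0 int"
  define a :: "'i \<times> 'x + 'y \<Rightarrow>\<^sub>0 int" where "a = ?s + frag_map Inr d"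
  have block_single: "block i (frag_map (\<lambda>x. Inl (j, x)) b :: 'i \<times> 'x + 'y \<Rightarrow>\<^sub>0 int) = (if j = i then b else 0)"
    for i j and b :: "'x \<Rightarrow>\<^sub>0 int"
    by (auto simp: block_def frag_map_def frag_extend_frag_extend frag_extend_eq_0
        simp flip: frag_expansion)
  have "block i a = c i" if "i \<in> I" for i
  proof -
    have "block i (frag_map Inr d :: 'i \<times> 'x + 'y \<Rightarrow>\<^sub>0 int) = 0"
      by (simp add: block_def frag_map_def frag_extend_frag_extend frag_extend_eq_0)
    moreover have "block i ?s = (\<Sum>j\<in>I. block i (frag_map (\<lambda>x. Inl (j, x)) (c j) :: 'i \<times> 'x + 'y \<Rightarrow>\<^sub>0 int))"
      unfolding block_def using assms(1) by (subst frag_extend_sum) (auto simp: o_def)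
    ultimately show ?thesis
      using assms(1) that by (simp add: a_def block_add block_single)
  qed
  moreover have "tail a = d"
  proof -
    have "tail (frag_map Inr d :: 'i \<times> 'x + 'y \<Rightarrow>\<^sub>0 int) = d"
      by (simp add: tail_def frag_map_def frag_extend_frag_extend flip: frag_expansion)
    moreover have "tail ?s = 0"
      unfolding tail_def using assms(1)
      by (subst frag_extend_sum) (auto simp: o_def frag_map_def frag_extend_frag_extend frag_extend_eq_0)
    ultimately show ?thesis
      by (simp add: a_def tail_add)
  qed
  moreover have "Poly_Mapping.keys a \<subseteq> (I \<times> X) <+> Y"
  proof -
    have "Poly_Mapping.keys (frag_map Inr d :: 'i \<times> 'x + 'y \<Rightarrow>\<^sub>0 int) \<subseteq> (I \<times> X) <+> Y"
      using assms(3) by (rule frag_map_keys_subset) auto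
    moreover have "Poly_Mapping.keys ?s \<subseteq> (I \<times> X) <+> Y"
    proof -
      have "Poly_Mapping.keys (frag_map (\<lambda>x. Inl (j, x)) (c j) :: 'i \<times> 'x + 'y \<Rightarrow>\<^sub>0 int) \<subseteq> (I \<times> X) <+> Y"
        if "j \<in> I" for j
        using assms(2)[OF that] by (rule frag_map_keys_subset) (use that in auto)
      then show ?thesis
        using keys_sum[of "\<lambda>j. frag_map (\<lambda>x. Inl (j, x)) (c j) :: 'i \<times> 'x + 'y \<Rightarrow>\<^sub>0 int" I] by blast
    qed
    ultimately show ?thesis
      unfolding a_def using keys_add[of ?s "frag_map Inr d"] by blast
  qed
  ultimately show ?thesis
    by blast
qed

text \<open>
  The coordinate of \<open>g\<close> applied to \<open>(i, x)\<close> is the one at the target index \<open>h i\<close>, because in the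
  wreath product \<open>(g, h)\<close> is the product of \<open>(g, id)\<close> and \<open>(1, h)\<close> in this order: \<open>h\<close> acts first.
\<close>

definition wreath_act ::
  "('g \<Rightarrow> 'x \<Rightarrow> 'x) \<Rightarrow> (('i \<Rightarrow> 'i) \<Rightarrow> 'y \<Rightarrow> 'y) \<Rightarrow> ('i \<Rightarrow> 'g) \<times> ('i \<Rightarrow> 'i) \<Rightarrow> 'i \<times> 'x + 'y \<Rightarrow> 'i \<times> 'x + 'y"
  where "wreath_act \<rho> \<sigma> p =
    map_sum (\<lambda>(i, x). (snd p i, \<rho> (fst p (snd p i)) x)) (\<sigma> (snd p))"

lemma wreath_act_simps [simp]:
  "wreath_act \<rho> \<sigma> (g, h) (Inl (i, x)) = Inl (h i, \<rho> (g (h i)) x)"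
  "wreath_act \<rho> \<sigma> (g, h) (Inr y) = Inr (\<sigma> h y)"
  by (simp_all add: wreath_act_def)

text \<open>
  The \<open>i\<close>-th block after acting by \<open>h\<close> comes from the block at \<open>h\<inverse> i\<close>. This index shift is exactly
  the one in the multiplication of the wreath product.
\<close>

lemma block_wreath_act:
  assumes "bij h"
  shows "block i (frag_map (wreath_act \<rho> \<sigma> (g, h)) c) = frag_map (\<rho> (g i)) (block (inv' h i) c)"
proof -
  have eq: "h j = i \<longleftrightarrow> j = inv' h i" for j
    using assms by (metis bij_inv_eq_iff)
  have h_inv: "h (inv' h i) = i"
    using assms by (simp add: bij_is_surj surj_f_inv_f)
  show ?thesis
    unfolding block_def frag_map_def frag_extend_frag_extend
    by (rule frag_extend_eq) (auto simp: eq h_inv split: sum.split)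
qed

lemma tail_wreath_act:
  "tail (frag_map (wreath_act \<rho> \<sigma> (g, h)) c) = frag_map (\<sigma> h) (tail c)"
  unfolding tail_def frag_map_def frag_extend_frag_extend
  by (rule frag_extend_eq) (auto split: sum.split)

text \<open>
  For faithfulness, the action on \<open>Y\<close> detects \<open>h\<close> first. Once \<open>h\<close> is the identity, the action on the
  \<open>i\<close>-th copy of \<open>X\<close> is that of \<open>g i\<close>. The nonemptiness of \<open>Y\<close> is what provides a nonempty basis
  when \<open>n = 0\<close>.
\<close>

lemma equivariant_cover_wreath_product:
  assumes "equivariant_cover G X \<rho> u"
    and H: "subgroup H (sym_group n)"
    and "equivariant_cover ((sym_group n)\<lparr>carrier := H\<rparr>) Y \<sigma> v"
  shows "equivariant_cover (wreath_product G n H) (({1..n} \<times> X) <+> Y) (wreath_act \<rho> \<sigma>)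
    (\<lambda>a. (\<lambda>i\<in>{1..n}. u (block i a), v (tail a)))"
proof -
  interpret G: equivariant_cover G X \<rho> u by (fact assms)
  interpret H: equivariant_cover "(sym_group n)\<lparr>carrier := H\<rparr>" Y \<sigma> v by (fact assms)
  let ?w = "\<lambda>a. (\<lambda>i\<in>{1..n}. u (block i a), v (tail a))"
  have perm: "h permutes {1..n}" if "h \<in> H" for h
    using subgroup.subset[OF H] that by (auto simp: subset_iff sym_group_carrier)
  have h_in: "h i \<in> {1..n}" if "h \<in> H" "i \<in> {1..n}" for h i
    using that by (simp only: permutes_in_image[OF perm])
  have inv_in: "inv' h i \<in> {1..n}" if "h \<in> H" "i \<in> {1..n}" for h i
    using that by (simp only: permutes_in_image[OF permutes_inv[OF perm]])
  have g_in: "g i \<in> carrier G" if "g \<in> {1..n} \<rightarrow>\<^sub>E carrier G" "i \<in> {1..n}" for g i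
    using that by blast
  have H_one: "\<sigma> id y = y" if "y \<in> Y" for y
    using H.act_one[OF that] by (simp add: sym_group_one)
  have H_mult: "\<sigma> (h \<circ> k) y = \<sigma> h (\<sigma> k y)" if "h \<in> H" "k \<in> H" "y \<in> Y" for h k y
    using H.act_mult[of h k y] that by (simp add: sym_group_mult)
  have w_closed: "?w a \<in> carrier (wreath_product G n H)"
    if "Poly_Mapping.keys a \<subseteq> ({1..n} \<times> X) <+> Y" for a
    using G.cover_closed[OF block_keys_subset[OF that]] H.cover_closed[OF tail_keys_subset[OF that]]
    by simp
  interpret W: group "wreath_product G n H"
    using G.is_group H by (rule group_wreath_product)
  show ?thesis
  proof
    show "finite (({1..n} \<times> X) <+> Y)"
      using G.finite_basis H.finite_basis by simp
    show "({1..n} \<times> X) <+> Y \<noteq> {}"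
      using H.basis_nonempty by auto
  next
    fix p z assume "p \<in> carrier (wreath_product G n H)" "z \<in> ({1..n} \<times> X) <+> Y"
    then show "wreath_act \<rho> \<sigma> p z \<in> ({1..n} \<times> X) <+> Y"
      using h_in by (cases p) (auto simp del: atLeastAtMost_iff simp: H.act_closed
          intro!: G.act_closed dest: g_in)
  next
    fix z assume "z \<in> ({1..n} \<times> X) <+> Y"
    then show "wreath_act \<rho> \<sigma> \<one>\<^bsub>wreath_product G n H\<^esub> z = z"
      by (auto simp: G.act_one H_one)
  next
    fix p q z
    assume p: "p \<in> carrier (wreath_product G n H)" and q: "q \<in> carrier (wreath_product G n H)"
      and z: "z \<in> ({1..n} \<times> X) <+> Y"
    obtain g h where gh: "p = (g, h)" "g \<in> {1..n} \<rightarrow>\<^sub>E carrier G" "h \<in> H"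
      using p by auto
    obtain g' h' where gh': "q = (g', h')" "g' \<in> {1..n} \<rightarrow>\<^sub>E carrier G" "h' \<in> H"
      using q by auto
    show "wreath_act \<rho> \<sigma> (p \<otimes>\<^bsub>wreath_product G n H\<^esub> q) z = wreath_act \<rho> \<sigma> p (wreath_act \<rho> \<sigma> q z)"
      using z
    proof (elim PlusE)
      fix b assume "b \<in> {1..n} \<times> X" "z = Inl b"
      then obtain i x where z: "z = Inl (i, x)" "i \<in> {1..n}" "x \<in> X"
        by auto
      have "h' i \<in> {1..n}" "h (h' i) \<in> {1..n}" "inv' h (h (h' i)) = h' i"
        using gh gh' z h_in permutes_inverses(2)[OF perm[OF gh(3)]] by auto
      then show ?thesis
        using z by (simp add: gh(1) gh'(1) G.act_mult g_in[OF gh(2)] g_in[OF gh'(2)]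
            del: atLeastAtMost_iff)
    qed (use gh gh' in \<open>simp add: H_mult\<close>)
  next
    fix p
    assume p: "p \<in> carrier (wreath_product G n H)"
      and fixed: "\<And>z. z \<in> ({1..n} \<times> X) <+> Y \<Longrightarrow> wreath_act \<rho> \<sigma> p z = z"
    obtain g h where gh: "p = (g, h)" "g \<in> {1..n} \<rightarrow>\<^sub>E carrier G" "h \<in> H"
      using p by auto
    have "\<sigma> h y = y" if "y \<in> Y" for y
      using fixed[OF InrI[OF that]] by (simp add: gh)
    then have h: "h = id"
      using H.faithful[of h] gh by (simp add: sym_group_one)
    have "g i = \<one>\<^bsub>G\<^esub>" if i: "i \<in> {1..n}" for i
    proof (rule G.faithful)
      show "\<rho> (g i) x = x" if "x \<in> X" for x
        using fixed[OF InlI[OF SigmaI[OF i that]]] by (simp add: gh h)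
    qed (use gh i in blast)
    then have "g = (\<lambda>i\<in>{1..n}. \<one>\<^bsub>G\<^esub>)"
      using gh(2) by (intro extensionalityI[of _ "{1..n}"]) (auto simp: PiE_iff)
    then show "p = \<one>\<^bsub>wreath_product G n H\<^esub>"
      by (simp add: gh h)
  next
    show "?w ` {a. Poly_Mapping.keys a \<subseteq> ({1..n} \<times> X) <+> Y} = carrier (wreath_product G n H)"
    proof (intro equalityI subsetI)
      fix p assume p: "p \<in> carrier (wreath_product G n H)"
      obtain g h where gh: "p = (g, h)" "g \<in> {1..n} \<rightarrow>\<^sub>E carrier G" "h \<in> H"
        using p by auto
      have "\<exists>c. Poly_Mapping.keys c \<subseteq> X \<and> u c = g i" if "i \<in> {1..n}" for i
        using G.cover_surj[OF g_in[OF gh(2) that]] by blast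
      then obtain c where c: "\<And>i. i \<in> {1..n} \<Longrightarrow> Poly_Mapping.keys (c i) \<subseteq> X \<and> u (c i) = g i"
        by metis
      obtain d where d: "Poly_Mapping.keys d \<subseteq> Y" "v d = h"
        using H.cover_surj[of h] gh(3) by auto
      obtain a where a: "Poly_Mapping.keys a \<subseteq> ({1..n} \<times> X) <+> Y"
        "\<And>i. i \<in> {1..n} \<Longrightarrow> block i a = c i" "tail a = d"
        using exists_blocks_tail[of "{1..n}" c X d Y] c d by auto
      have "(\<lambda>i\<in>{1..n}. u (block i a)) = g"
        using gh(2) a c by (intro extensionalityI[of _ "{1..n}"]) (auto simp: PiE_iff)
      then show "p \<in> ?w ` {a. Poly_Mapping.keys a \<subseteq> ({1..n} \<times> X) <+> Y}"
        using a d gh by (intro image_eqI[of _ _ a]) auto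
    qed (use w_closed in blast)
  next
    fix a c :: "_ \<Rightarrow>\<^sub>0 int"
    assume a: "Poly_Mapping.keys a \<subseteq> ({1..n} \<times> X) <+> Y"
      and c: "Poly_Mapping.keys c \<subseteq> ({1..n} \<times> X) <+> Y"
    let ?h = "v (tail a)"
    have h: "?h \<in> H"
      using H.cover_closed[OF tail_keys_subset[OF a]] by simp
    have bij: "bij ?h"
      using perm[OF h] by (rule permutes_bij)
    have "u (block i (a + frag_map (wreath_act \<rho> \<sigma> (?w a)) c)) = u (block i a) \<otimes>\<^bsub>G\<^esub> u (block (inv' ?h i) c)"
      if "i \<in> {1..n}" for i
      using that G.cocycle[OF block_keys_subset[OF a] block_keys_subset[OF c]]
      by (simp add: block_add block_wreath_act[OF bij])
    moreover have "v (tail (a + frag_map (wreath_act \<rho> \<sigma> (?w a)) c)) = ?h \<circ> v (tail c)"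
      using H.cocycle[OF tail_keys_subset[OF a] tail_keys_subset[OF c]]
      by (simp add: tail_add tail_wreath_act sym_group_mult)
    ultimately show "?w (a + frag_map (wreath_act \<rho> \<sigma> (?w a)) c) = ?w a \<otimes>\<^bsub>wreath_product G n H\<^esub> ?w c"
      using inv_in[OF h] by (simp add: fun_eq_iff del: atLeastAtMost_iff)
  qed
qed

theorem corollary3p5:
  fixes G :: "('a, 'b) monoid_scheme" and n :: nat and H :: "(nat \<Rightarrow> nat) set"
  assumes "IYB_group G"
    and "subgroup H (sym_group n)"
    and "IYB_group ((sym_group n)\<lparr>carrier := H\<rparr>)"
  shows "IYB_group (wreath_product G n H)"
proof -
  obtain k \<rho> u where "equivariant_cover G {1..k::nat} \<rho> u"
    using IYB_group_imp_cover[OF assms(1)] by blast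
  moreover obtain l \<sigma> v
    where "equivariant_cover ((sym_group n)\<lparr>carrier := H\<rparr>) {1..l::nat} \<sigma> v"
    using IYB_group_imp_cover[OF assms(3)] by blast
  ultimately show ?thesis
    using assms(2) equivariant_cover_wreath_product by (blast intro: IYB_group_if_cover)
qed

end
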